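(* Let $[c,d]\subset\mathbb{R}$ be a closed interval, let $f:[c,d]\to\mathbb{R}$ be the function to approximate, let $D$ be a convex subset of a real vector space (the set of admissible parameters), and let $F:D\times[c,d]\to\mathbb{R}$, where $F(A,\cdot)$ is the approximation with parameters $A\in D$. Assume that for every $A\in D$ the maximum $\max_{t\in[c,d]}|F(A,t)-f(t)|$ exists. Suppose that for every fixed $t\in[c,d]$ the function $A\mapsto F(A,t)$ is quasilinear on $D$. Then the Chebyshev approximation problem $$\min_{A\in D}\ \max_{t\in[c,d]}|F(A,t)-f(t)|$$ is quasiconvex, that is, its objective function $\Phi:D\to\mathbb{R}$, $$\Phi(A)=\max_{t\in[c,d]}|F(A,t)-f(t)|,$$ is quasiconvex on $D$.
   Context: Let $D$ be a convex subset of a real vector space. A function $g:D\to\mathbb{R}$ is quasiconvex if for all $x,y\in D$ and $\lambda\in[0,1]$ one has $g(\lambda x+(1-\lambda)y)\le\max\{g(x),g(y)\}$; equivalently, the sublevel set $\{x\in D: g(x)\le\alpha\}$ is convex for every $\alpha\in\mathbb{R}$. A function $g$ is quasiconcave if $-g$ is quasiconvex. A function is quasilinear (also called quasiaffine) if it is both quasiconvex and quasiconcave. The parameters $A$ of the approximation are the decision variables of the optimisation problem. *)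

theory Defs
  imports "HOL-Analysis.Analysis"
begin

text \<open>As in the library's \<^const>\<open>convex_on\<close>, convexity of the domain is part of the notion.\<close>

definition quasiconvex_on :: "'a::real_vector set \<Rightarrow> ('a \<Rightarrow> real) \<Rightarrow> bool" where
  "quasiconvex_on D g \<longleftrightarrow> convex D \<and>
     (\<forall>x\<in>D. \<forall>y\<in>D. \<forall>u\<in>{0..1}. g (u *\<^sub>R x + (1 - u) *\<^sub>R y) \<le> max (g x) (g y))"

definition quasiconcave_on :: "'a::real_vector set \<Rightarrow> ('a \<Rightarrow> real) \<Rightarrow> bool" where
  "quasiconcave_on D g \<longleftrightarrow> quasiconvex_on D (\<lambda>x. - g x)"

definition quasilinear_on :: "'a::real_vector set \<Rightarrow> ('a \<Rightarrow> real) \<Rightarrow> bool" where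
  "quasilinear_on D g \<longleftrightarrow> quasiconvex_on D g \<and> quasiconcave_on D g"

text \<open>The maximum over an interval is the greatest element of the (in general infinite) set of
  values, so \<^const>\<open>Max\<close> does not apply. The value below is meaningful only if the maximum
  is attained.\<close>

definition chebyshev_objective ::
    "real \<Rightarrow> real \<Rightarrow> (real \<Rightarrow> real) \<Rightarrow> ('a \<Rightarrow> real \<Rightarrow> real) \<Rightarrow> 'a \<Rightarrow> real" where
  "chebyshev_objective c d f F A = (GREATEST v. v \<in> (\<lambda>t. \<bar>F A t - f t\<bar>) ` {c..d})"

end

theory Submission
  imports Defs
begin

text \<open>A pointwise maximum of quasiconvex functions is quasiconvex, so the question reduces to
  a single t. There quasilinearity confines the value of \<open>F\<close> at a convex combination to
  the interval spanned by its values at the two end parameters, and the distance to the constant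
  \<open>f t\<close> is largest at an endpoint of an interval
  (\<open>quasilinear_on_abs_diff_le\<close>). Attainment of the maxima lets
  \<open>chebyshev_objective_eqI\<close> identify the objective with an actual deviation.\<close>

lemma chebyshev_objective_eqI:
  assumes "s \<in> {c..d}" and "\<And>t. t \<in> {c..d} \<Longrightarrow> \<bar>F A t - f t\<bar> \<le> \<bar>F A s - f s\<bar>"
  shows "chebyshev_objective c d f F A = \<bar>F A s - f s\<bar>"
  unfolding chebyshev_objective_def
  using assms by (intro Greatest_equality) auto

text \<open>Quasiconvexity bounds the value at the combination by the larger of \<open>g x\<close>
  and \<open>g y\<close>, quasiconcavity by the smaller from below; the convex function |v - r| on
  that interval peaks at an endpoint.\<close>

lemma quasilinear_on_abs_diff_le:
  fixes r :: real
  assumes "quasilinear_on D g" "x \<in> D" "y \<in> D" "u \<in> {0..1}"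
  shows "\<bar>g (u *\<^sub>R x + (1 - u) *\<^sub>R y) - r\<bar> \<le> max \<bar>g x - r\<bar> \<bar>g y - r\<bar>"
proof -
  let ?z = "u *\<^sub>R x + (1 - u) *\<^sub>R y"
  have "g ?z \<le> max (g x) (g y)" "- g ?z \<le> max (- g x) (- g y)"
    using assms
    unfolding quasilinear_on_def quasiconcave_on_def quasiconvex_on_def by blast+
  then show ?thesis
    by linarith
qed

theorem lemma1:
  fixes c d :: real
    and f :: "real \<Rightarrow> real"
    and D :: "'a::real_vector set"
    and F :: "'a \<Rightarrow> real \<Rightarrow> real"
  assumes "c \<le> d"
    and "convex D"
    and "\<And>A. A \<in> D \<Longrightarrow> \<exists>s\<in>{c..d}. \<forall>t\<in>{c..d}. \<bar>F A t - f t\<bar> \<le> \<bar>F A s - f s\<bar>"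
    and "\<And>t. t \<in> {c..d} \<Longrightarrow> quasilinear_on D (\<lambda>A. F A t)"
  shows "quasiconvex_on D (chebyshev_objective c d f F)"
proof -
  let ?\<Phi> = "chebyshev_objective c d f F"
  \<comment> \<open>Attainment enters here: without a greatest value, \<open>GREATEST\<close> would
    be unspecified and need not bound anything.\<close>
  have bound: "\<bar>F A t - f t\<bar> \<le> ?\<Phi> A" if "A \<in> D" "t \<in> {c..d}" for A t
    using assms(3)[OF that(1)] that(2) chebyshev_objective_eqI[of _ c d F A f] by metis
  have "?\<Phi> (u *\<^sub>R x + (1 - u) *\<^sub>R y) \<le> max (?\<Phi> x) (?\<Phi> y)"
    if xy: "x \<in> D" "y \<in> D" and u: "u \<in> {0..1}" for x y u
  proof -
    let ?z = "u *\<^sub>R x + (1 - u) *\<^sub>R y"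
    have "?z \<in> D"
      using \<open>convex D\<close> xy u by (simp add: convexD)
    \<comment> \<open>A point of worst deviation for the combination \<open>?z\<close> fixes the
      single t at which all three parameters are compared.\<close>
    then obtain s where s: "s \<in> {c..d}" "\<And>t. t \<in> {c..d} \<Longrightarrow> \<bar>F ?z t - f t\<bar> \<le> \<bar>F ?z s - f s\<bar>"
      using assms(3) by blast
    then have "?\<Phi> ?z = \<bar>F ?z s - f s\<bar>"
      by (rule chebyshev_objective_eqI)
    also have "\<dots> \<le> max \<bar>F x s - f s\<bar> \<bar>F y s - f s\<bar>"
      using quasilinear_on_abs_diff_le[OF assms(4)[OF s(1)] xy u] .
    \<comment> \<open>The point \<open>s\<close> need not be worst for \<open>x\<close> or
      \<open>y\<close>; an upper bound on their deviations is enough.\<close>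
    also have "\<dots> \<le> max (?\<Phi> x) (?\<Phi> y)"
      using bound xy s(1) by (intro max.mono) auto
    finally show ?thesis .
  qed
  then show ?thesis
    using \<open>convex D\<close> unfolding quasiconvex_on_def by blast
qed

end
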